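(* Let $X\in\{0,\pm1\}^{n\times n}$ be symmetric. Then $X\succeq\mathbf 0$ if and only if $X=\sum_{j=1}^r x_jx_j^\top$ for some $r$ and some $x_j\in\{0,\pm1\}^n$, $j\in[r]$.
   Context: $X\succeq\mathbf 0$ means $X$ is positive semidefinite; $[r]=\{1,\dots,r\}$; the empty sum ($r=0$) is the zero matrix. *)

theory Defs
  imports "HOL-Analysis.Analysis"
begin

definition pos_semidef :: "real ^ 'n ^ 'n \<Rightarrow> bool" where
  "pos_semidef A \<longleftrightarrow> transpose A = A \<and> (\<forall>v. 0 \<le> v \<bullet> (A *v v))"

definition outer_product :: "real ^ 'm \<Rightarrow> real ^ 'n \<Rightarrow> real ^ 'n ^ 'm" where
  "outer_product x y = (\<chi> i j. x $ i * y $ j)"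

text \<open>The index type \<open>1\<close> has exactly one element, so \<open>columnvector x\<close> is the
  one-column matrix usually identified with the vector \<open>x\<close>; the outer product is the
  matrix product of this column with a row.\<close>

lemma outer_product_eq_matrix_mult:
  "outer_product x y = (columnvector x :: real ^ 1 ^ 'm) ** transpose (columnvector y :: real ^ 1 ^ 'n)"
  by (simp add: outer_product_def columnvector_def transpose_def matrix_matrix_mult_def)

end

theory Submission
  imports Defs
begin

text \<open>If an entry \<open>X\<^sub>i\<^sub>j\<close> of the positive semidefinite matrix is nonzero, the quadratic form at
  \<open>e\<^sub>i - X\<^sub>i\<^sub>j e\<^sub>j\<close> equals \<open>X\<^sub>i\<^sub>i + X\<^sub>j\<^sub>j - 2\<close>. Being nonnegative, it must vanish, so this vector lies in
  the kernel and row \<open>i\<close> is \<open>X\<^sub>i\<^sub>j\<close> times row \<open>j\<close>. Hence \<open>X\<^sub>i\<^sub>j \<noteq> 0\<close> is an equivalence relation on the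
  indices with nonzero diagonal entry, and \<open>X\<close> is the sum of the outer squares of one row from each
  class.\<close>

lemma inner_symmetric_matrix:
  fixes A :: "real ^ 'n ^ 'n"
  assumes "transpose A = A"
  shows "v \<bullet> (A *v w) = w \<bullet> (A *v v)"
  by (metis assms dot_lmul_matrix inner_commute transpose_matrix_vector)

lemma pos_semidef_entry_commute:
  assumes "pos_semidef A"
  shows "A $ i $ j = A $ j $ i"
proof -
  have "transpose A $ j $ i = A $ j $ i"
    using assms by (simp add: pos_semidef_def)
  then show ?thesis by (simp add: transpose_def)
qed

text \<open>On the line \<open>w + s v\<close> with \<open>w = A v\<close>, the form has no
  quadratic term in \<open>s\<close>, and its linear coefficient is twice the squared norm of
  \<open>A v\<close>. An affine function bounded below is constant, so \<open>A v\<close>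
  vanishes.\<close>

lemma pos_semidef_null_vector:
  fixes A :: "real ^ 'n ^ 'n"
  assumes "pos_semidef A" and null: "v \<bullet> (A *v v) = 0"
  shows "A *v v = 0"
proof (rule ccontr)
  assume "A *v v \<noteq> 0"
  define w where "w = A *v v"
  define c where "c = w \<bullet> (A *v v)"
  \<comment> \<open>The solution of \<open>2 * s * c + w \<bullet> (A *v w) = -1\<close>.\<close>
  define s where "s = - (w \<bullet> (A *v w) + 1) / (2 * c)"
  have sym: "transpose A = A" and psd: "\<And>v. 0 \<le> v \<bullet> (A *v v)"
    using assms by (auto simp: pos_semidef_def)
  have "c \<noteq> 0"
    using \<open>A *v v \<noteq> 0\<close> by (simp add: c_def w_def)
  have "(s *\<^sub>R v + w) \<bullet> (A *v (s *\<^sub>R v + w)) = 2 * s * c + w \<bullet> (A *v w)"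
    using null inner_symmetric_matrix[OF sym, of v w]
    by (simp add: c_def matrix_vector_right_distrib matrix_vector_mult_scaleR
        inner_add_left inner_add_right)
  also have "\<dots> = -1"
    using \<open>c \<noteq> 0\<close> by (simp add: s_def divide_simps)
  finally show False
    using psd[of "s *\<^sub>R v + w"] by simp
qed

text \<open>The quadratic form at \<open>v\<close> is the square of
  \<open>x \<bullet> v\<close>.\<close>

lemma pos_semidef_outer_product: "pos_semidef (outer_product x x)"
proof -
  have "outer_product x x *v v = (x \<bullet> v) *\<^sub>R x" for v :: "real ^ 'a"
    by (simp add: outer_product_def matrix_vector_mult_def vec_eq_iff inner_vec_def
        sum_distrib_left sum_distrib_right mult_ac)
  then show ?thesis
    by (simp add: pos_semidef_def inner_commute)
      (simp add: outer_product_def transpose_def mult.commute)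
qed

lemma pos_semidef_sum:
  assumes "\<And>j. j \<in> J \<Longrightarrow> pos_semidef (A j)"
  shows "pos_semidef (\<Sum>j\<in>J. A j)"
  using assms
proof (induction J rule: infinite_finite_induct)
  case (insert j J)
  then show ?case
    by (simp add: pos_semidef_def matrix_vector_mult_add_rdistrib inner_add_right)
      (simp add: transpose_def vec_eq_iff)
qed (simp_all add: pos_semidef_def transpose_def vec_eq_iff)

lemma pos_semidef_unit_entry:
  fixes X :: "real ^ 'n ^ 'n"
  assumes entries: "\<And>i j. X $ i $ j \<in> {0, 1, -1}"
    and psd: "pos_semidef X" and nz: "X $ i $ j \<noteq> 0"
  shows "X $ i $ i = 1" and "X $ i $ k = X $ i $ j * X $ j $ k"
proof -
  note swap = pos_semidef_entry_commute[OF psd]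
  define v :: "real ^ 'n" where "v = axis i 1 - (X $ i $ j) *\<^sub>R axis j 1"
  have Xv: "(X *v v) $ a = X $ a $ i - X $ i $ j * X $ a $ j" for a
    by (simp add: v_def matrix_vector_mult_diff_distrib matrix_vector_mult_scaleR
        matrix_vector_mult_basis column_def)
  have sq: "X $ i $ j * X $ i $ j = 1"
    using entries[of i j] nz by auto
  then have sq': "X $ i $ j * (X $ i $ j * c) = c" for c
    by (metis mult.assoc mult_1)
  have "v \<bullet> (X *v v) = (X *v v) $ i - X $ i $ j * (X *v v) $ j"
    by (simp add: v_def inner_diff_left inner_axis')
  also have "\<dots> = X $ i $ i + X $ j $ j - 2"
    using sq sq' swap[of j i] by (simp add: Xv algebra_simps)
  finally have q: "v \<bullet> (X *v v) = X $ i $ i + X $ j $ j - 2" .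
  moreover have "0 \<le> v \<bullet> (X *v v)"
    using psd by (simp add: pos_semidef_def)
  \<comment> \<open>The two diagonal entries are at most 1 and sum to at least 2.\<close>
  ultimately have diag: "X $ i $ i = 1" "X $ j $ j = 1"
    using entries[of i i] entries[of j j] by auto
  then show "X $ i $ i = 1" by simp
  have "X *v v = 0"
    using pos_semidef_null_vector[OF psd] q diag by simp
  then show "X $ i $ k = X $ i $ j * X $ j $ k"
    using Xv[of k] swap[of k i] swap[of k j] by simp
qed

lemma pos_semidef_unit_decomposition:
  fixes X :: "real ^ 'n ^ 'n"
  assumes entries: "\<And>i j. X $ i $ j \<in> {0, 1, -1}" and psd: "pos_semidef X"
  obtains R where "X = (\<Sum>k\<in>R. outer_product (X $ k) (X $ k))"
proof
  \<comment> \<open>The choice depends only on the support of row \<open>i\<close>, so indices whose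
    rows have equal support share a representative. Zero rows get an arbitrary value, which
    \<open>R\<close> leaves out.\<close>
  define rep where "rep i = (SOME j. X $ i $ j \<noteq> 0)" for i
  define R where "R = rep ` {i. X $ i $ i \<noteq> 0}"
  note swap = pos_semidef_entry_commute[OF psd]
  note unit = pos_semidef_unit_entry[OF entries psd]
  have rep: "X $ i $ rep i \<noteq> 0" if "X $ i $ i \<noteq> 0" for i
    unfolding rep_def by (rule someI[of _ i]) (rule that)
  have rep_eq: "rep i = rep j" if "X $ i $ j \<noteq> 0" for i j
  proof -
    have "X $ i $ k \<noteq> 0 \<longleftrightarrow> X $ j $ k \<noteq> 0" for k
      using unit(2)[OF that, of k] that by simp
    then show ?thesis by (simp add: rep_def)
  qed
  have entry: "X $ i $ j = (\<Sum>k\<in>R. X $ k $ i * X $ k $ j)" for i j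
  proof (cases "X $ i $ i = 0")
    case True
    \<comment> \<open>A nonzero entry in row \<open>i\<close> would force the diagonal entry to be
      1.\<close>
    then have row: "X $ i $ k = 0" for k
      using unit(1)[of i k] zero_neq_one by metis
    then have "X $ k $ i = 0" for k
      by (metis swap)
    with row show ?thesis by simp
  next
    case False
    \<comment> \<open>At most one summand survives: \<open>k = rep l\<close> lies in the class of
      \<open>l\<close>, so \<open>rep k = k\<close>, while a nonzero \<open>X $ k $ i\<close> gives
      \<open>rep k = rep i\<close>.\<close>
    have "k = rep i" if "k \<in> R" "X $ k $ i \<noteq> 0" for k
    proof -
      obtain l where l: "k = rep l" "X $ l $ l \<noteq> 0"
        using \<open>k \<in> R\<close> by (auto simp: R_def)
      then have "rep l = rep k"
        using rep rep_eq by blast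
      then show ?thesis
        using rep_eq[OF that(2)] l(1) by simp
    qed
    then have "(\<Sum>k\<in>R. X $ k $ i * X $ k $ j) = (\<Sum>k\<in>{rep i}. X $ k $ i * X $ k $ j)"
      using False by (intro sum.mono_neutral_right) (auto simp: R_def)
    also have "\<dots> = X $ i $ j"
      using unit(2)[OF rep[OF False], of j] swap[of i "rep i"] by simp
    finally show ?thesis ..
  qed
  have "(\<Sum>k\<in>R. outer_product (X $ k) (X $ k)) $ i $ j = X $ i $ j" for i j
    by (subst entry) (simp add: outer_product_def)
  then show "X = (\<Sum>k\<in>R. outer_product (X $ k) (X $ k))"
    unfolding vec_eq_iff by metis
qed

theorem theorem8:
  fixes X :: "real ^ 'n ^ 'n"
  assumes entries: "\<And>i j. X $ i $ j \<in> {0, 1, -1}"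
    and symmetric: "transpose X = X"
  shows "pos_semidef X \<longleftrightarrow>
    (\<exists>(r::nat) (x :: nat \<Rightarrow> real ^ 'n).
      (\<forall>j\<in>{1..r}. \<forall>i. x j $ i \<in> {0, 1, -1}) \<and>
      X = (\<Sum>j\<in>{1..r}. outer_product (x j) (x j)))"
proof
  assume "pos_semidef X"
  then obtain R where R: "X = (\<Sum>k\<in>R. outer_product (X $ k) (X $ k))"
    using pos_semidef_unit_decomposition entries by blast
  \<comment> \<open>\<open>R\<close> is finite as a set over a finite index type. Its enumeration
    turns the chosen rows of \<open>X\<close>, whose entries are admissible already, into the
    vectors \<open>x j\<close>.\<close>
  obtain h where h: "bij_betw h {1..card R} R"
    using ex_bij_betw_nat_finite_1[of R] by auto
  have "X = (\<Sum>j\<in>{1..card R}. outer_product (X $ h j) (X $ h j))"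
    by (rule trans[OF R sum.reindex_bij_betw[OF h, symmetric]])
  then show "\<exists>(r::nat) (x :: nat \<Rightarrow> real ^ 'n).
      (\<forall>j\<in>{1..r}. \<forall>i. x j $ i \<in> {0, 1, -1}) \<and>
      X = (\<Sum>j\<in>{1..r}. outer_product (x j) (x j))"
    using entries by (intro exI[of _ "card R"] exI[of _ "\<lambda>j. X $ h j"]) blast
next
  assume "\<exists>(r::nat) (x :: nat \<Rightarrow> real ^ 'n).
      (\<forall>j\<in>{1..r}. \<forall>i. x j $ i \<in> {0, 1, -1}) \<and>
      X = (\<Sum>j\<in>{1..r}. outer_product (x j) (x j))"
  then show "pos_semidef X"
    by (metis pos_semidef_sum pos_semidef_outer_product)
qed

end
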